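(* Let $X$ be a normed space, let $F\subseteq X$ be a nonempty closed convex set with $0\in\mathrm{int}\,F$, and let $Q\subseteq X$ be nonempty. Let $$\ell=\inf\Big\{\frac1r: r>0,\ \mathbb{B}(0;r)\subset F\Big\}.$$ Then the minimal time function $\mathcal{T}^F_Q$ is $\ell$-Lipschitz.
   Context: Normed spaces are real. $\mathbb{B}(0;r)$ is the closed ball of radius $r$ centered at $0$. For $t\ge 0$, $tF=\{tf: f\in F\}$ (so $0F=\{0\}$). The minimal time function is $\mathcal{T}^F_Q(x)=\inf\{t\ge 0: (x+tF)\cap Q\ne\emptyset\}$. A function $\varphi:X\to\mathbb{R}$ is $\ell$-Lipschitz if $|\varphi(x)-\varphi(y)|\le\ell\|x-y\|$ for all $x,y\in X$ (in particular, the claim includes that $\mathcal{T}^F_Q$ is finite everywhere). *)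

theory Defs
  imports "HOL-Analysis.Analysis"
begin

(* Extended-real valued, so that the infimum over the empty set of times is \<infinity>
   and finiteness of the function is a genuine claim. *)
definition minimal_time :: "'a::real_normed_vector set \<Rightarrow> 'a set \<Rightarrow> 'a \<Rightarrow> ereal" where
  "minimal_time F Q x =
     Inf {ereal t | t. t \<ge> 0 \<and> ((+) x ` ((*\<^sub>R) t ` F)) \<inter> Q \<noteq> {}}"

end

theory Submission
  imports Defs
begin

text \<open>If \<open>cball 0 r \<subseteq> F\<close>, then \<open>y - x\<close> lies in \<open>s F\<close> for \<open>s = \<parallel>y - x\<parallel> / r\<close>, and convexity gives
  \<open>s F + t F \<subseteq> (s + t) F\<close>. So whenever \<open>y\<close> reaches \<open>Q\<close> in time \<open>t\<close>, the point \<open>x\<close> reaches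
  \<open>Q\<close> in time \<open>s + t\<close>; taking infima over \<open>t\<close> and then over \<open>r\<close> gives the Lipschitz bound.\<close>

lemma minimal_time_le:
  assumes "t \<ge> 0" and "f \<in> F" and "x + t *\<^sub>R f \<in> Q"
  shows "minimal_time F Q x \<le> ereal t"
  unfolding minimal_time_def using assms by (intro Inf_lower) blast

lemma minimal_time_greatest:
  assumes "\<And>t f. t \<ge> 0 \<Longrightarrow> f \<in> F \<Longrightarrow> x + t *\<^sub>R f \<in> Q \<Longrightarrow> c \<le> ereal t"
  shows "c \<le> minimal_time F Q x"
  unfolding minimal_time_def using assms by (intro Inf_greatest) blast

lemma minimal_time_nonneg: "0 \<le> minimal_time F Q x"
  by (rule minimal_time_greatest) simp

text \<open>For \<open>s + t > 0\<close>, dividing by \<open>s + t\<close> turns the left side into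
  a convex combination of \<open>g\<close> and \<open>f\<close>. If \<open>s + t = 0\<close>, both
  coefficients vanish and any point of \<open>F\<close> serves.\<close>

lemma convex_scaled_add:
  fixes f g :: "'a::real_vector"
  assumes "convex F" and "f \<in> F" and "g \<in> F" and "s \<ge> 0" and "t \<ge> 0"
  obtains h where "h \<in> F" and "s *\<^sub>R g + t *\<^sub>R f = (s + t) *\<^sub>R h"
proof (cases "s + t = 0")
  case True
  then have "s = 0" "t = 0" using assms(4,5) by auto
  then show thesis using assms(2) that by simp
next
  case False
  let ?h = "(s / (s + t)) *\<^sub>R g + (t / (s + t)) *\<^sub>R f"
  have "?h \<in> F"
    using assms False by (intro convexD) (auto simp flip: add_divide_distrib)
  moreover have "s *\<^sub>R g + t *\<^sub>R f = (s + t) *\<^sub>R ?h"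
    using False by (simp add: scaleR_add_right)
  ultimately show thesis by (rule that)
qed

lemma cball_subset_scaled:
  fixes v :: "'a::real_normed_vector"
  assumes "r > 0" and "cball 0 r \<subseteq> F"
  obtains g where "g \<in> F" and "v = (norm v / r) *\<^sub>R g"
proof
  \<comment> \<open>The witness is \<open>v\<close> rescaled to norm \<open>r\<close>. For
    \<open>v = 0\<close> the convention \<open>r / 0 = 0\<close> makes it the center of the ball, so
    no case split arises.\<close>
  show "(r / norm v) *\<^sub>R v \<in> F"
    using assms by (intro subsetD[OF assms(2)]) simp
  show "v = (norm v / r) *\<^sub>R ((r / norm v) *\<^sub>R v)"
    using assms(1) by simp
qed

lemma minimal_time_le_add:
  fixes x y :: "'a::real_normed_vector"
  assumes "convex F" and "r > 0" and "cball 0 r \<subseteq> F"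
  shows "minimal_time F Q x \<le> minimal_time F Q y + ereal (dist x y / r)"
proof -
  \<comment> \<open>With the real summand moved to the left, the claim is a lower bound for every
    time in which \<open>y\<close> reaches \<open>Q\<close>.\<close>
  have "minimal_time F Q x - ereal (dist x y / r) \<le> minimal_time F Q y"
  proof (rule minimal_time_greatest)
    fix t f assume t: "t \<ge> 0" and f: "f \<in> F" and q: "y + t *\<^sub>R f \<in> Q"
    obtain g where g: "g \<in> F" "y - x = (norm (y - x) / r) *\<^sub>R g"
      using cball_subset_scaled[OF assms(2,3)] .
    let ?s = "dist x y / r"
    have s: "?s \<ge> 0" using assms(2) by simp
    obtain h where h: "h \<in> F" "?s *\<^sub>R g + t *\<^sub>R f = (?s + t) *\<^sub>R h"
      using convex_scaled_add[OF assms(1) f g(1) s t] .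
    have "y = x + ?s *\<^sub>R g"
      using g(2) by (simp add: dist_norm norm_minus_commute algebra_simps)
    \<comment> \<open>Going from \<open>x\<close> to \<open>y\<close> and then on to
      \<open>Q\<close> is merged into a single move along \<open>h\<close>.\<close>
    then have "x + (?s + t) *\<^sub>R h = y + t *\<^sub>R f"
      by (simp flip: h(2) add: add.assoc)
    then have "minimal_time F Q x \<le> ereal (?s + t)"
      using s t h(1) q by (intro minimal_time_le[where f = h]) auto
    then show "minimal_time F Q x - ereal ?s \<le> ereal t"
      by (simp add: ereal_minus_le add.commute)
  qed
  then show ?thesis by (simp add: ereal_minus_le)
qed

text \<open>Points of \<open>Q\<close> have minimal time 0, so comparison with one of them bounds
  the value at \<open>x\<close> from above; nonnegativity excludes
  \<open>-\<infinity>\<close>.\<close>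

lemma minimal_time_finite:
  fixes x :: "'a::real_normed_vector"
  assumes "convex F" and "r > 0" and "cball 0 r \<subseteq> F" and "Q \<noteq> {}"
  shows "\<bar>minimal_time F Q x\<bar> \<noteq> \<infinity>"
proof -
  obtain q where q: "q \<in> Q" using assms(4) by blast
  have "0 \<in> F" using assms(2,3) by auto
  then have "minimal_time F Q q \<le> 0"
    using q minimal_time_le[of 0 0 F q Q] by (simp add: zero_ereal_def)
  then have "minimal_time F Q x \<le> 0 + ereal (dist x q / r)"
    using minimal_time_le_add[OF assms(1-3)] by (meson add_right_mono order_trans)
  then show ?thesis
    using minimal_time_nonneg[of F Q x] by auto
qed

theorem theorem3p4:
  fixes F Q :: "'a::real_normed_vector set" and l :: real
  assumes "F \<noteq> {}" and "closed F" and "convex F" and "0 \<in> interior F"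
    and "Q \<noteq> {}"
    and "l = Inf {1 / r | r. r > 0 \<and> cball 0 r \<subseteq> F}"
  shows "(\<forall>x. \<bar>minimal_time F Q x\<bar> \<noteq> \<infinity>) \<and>
         l-lipschitz_on UNIV (\<lambda>x. real_of_ereal (minimal_time F Q x))"
proof -
  let ?R = "{1 / r | r. r > 0 \<and> cball 0 r \<subseteq> F}"
  let ?T = "\<lambda>x. real_of_ereal (minimal_time F Q x)"
  obtain r where r: "r > 0" "cball 0 r \<subseteq> F"
    using assms(4) by (auto simp: mem_interior_cball)
  \<comment> \<open>A real \<open>Inf\<close> can be bounded from below elementwise only over a
    nonempty set.\<close>
  then have ne: "?R \<noteq> {}" by blast
  have fin: "\<bar>minimal_time F Q x\<bar> \<noteq> \<infinity>" for x
    using minimal_time_finite[OF assms(3) r assms(5)] .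
  have diff: "?T x - ?T y \<le> dist x y / r'" if "r' > 0" "cball 0 r' \<subseteq> F" for x y r'
  proof -
    have "ereal (?T x) \<le> ereal (?T y) + ereal (dist x y / r')"
      using minimal_time_le_add[OF assms(3) that] fin by (simp add: ereal_real')
    then show ?thesis by simp
  qed
  have "l-lipschitz_on UNIV ?T"
  proof (rule lipschitz_onI)
    show "0 \<le> l"
      unfolding assms(6) using ne by (intro cInf_greatest) auto
    fix x y :: 'a
    show "dist (?T x) (?T y) \<le> l * dist x y"
    proof (cases "x = y")
      case False
      \<comment> \<open>Division by \<open>dist x y\<close> isolates a quantity independent of the
        radius, which is then shown to be a lower bound of \<open>?R\<close>.\<close>
      have "dist (?T x) (?T y) / dist x y \<le> l"
        unfolding assms(6)
      proof (rule cInf_greatest[OF ne])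
        fix c assume "c \<in> ?R"
        then obtain r' where r': "c = 1 / r'" "r' > 0" "cball 0 r' \<subseteq> F" by blast
        \<comment> \<open>The one-sided estimate, used in both orders of \<open>x\<close> and
          \<open>y\<close>, bounds the absolute value.\<close>
        have "dist (?T x) (?T y) \<le> dist x y / r'"
          using diff[OF r'(2,3), of x y] diff[OF r'(2,3), of y x]
          by (simp add: dist_real_def dist_commute abs_le_iff)
        then show "dist (?T x) (?T y) / dist x y \<le> c"
          using False by (simp add: r'(1) pos_divide_le_eq)
      qed
      then show ?thesis using False by (simp add: pos_divide_le_eq)
    qed simp
  qed
  with fin show ?thesis by blast
qed

end
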